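(* Let $\sigma:\mathbb{R}\to\mathbb{R}$ be a Tauber--Wiener function. Let $\Omega_W$ be a compact subset of a Banach space $\mathcal{A}$ and $W\subseteq C^0(\Omega_W)$ a compact set; let $\Omega_U$ be a compact subset of a Banach space $\mathcal{U}$ and $U\subseteq C^0(\Omega_U)$ a compact set; let $\Omega_V\subset\mathbb{R}^n$ be compact and $V=C^0(\Omega_V)$. For every $\alpha\in W$ let $G[\alpha]:U\to V$ be a nonlinear (i.e. not necessarily linear) continuous operator, and assume that the map $\alpha\in W\mapsto G[\alpha]$ is continuous. Then for any $\varepsilon>0$ and for each of the two network forms (MONet) and (MNO) given in the context, there exists a network $\mathrm{NN}$ of that form, with activation $\sigma$, such that $$\left\| G[\alpha][u](x)-\mathrm{NN}[\boldsymbol{\alpha}][\mathbf{u}](x)\right\|_{L^\infty(W\times U\times\Omega_V)}<\varepsilon$$ for all functions $\alpha\in W$ and $u\in U$, where $\boldsymbol{\alpha}$ and $\mathbf{u}$ are discretizations of $\alpha$ and $u$ that only depend on $W$ and $U$ respectively.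
   Context: Tauber--Wiener function: $\sigma:\mathbb{R}\to\mathbb{R}$ such that for all $a<b$, $\varepsilon>0$ and $f\in C^0([a,b])$ there is a finite linear combination $g(x)=\sum_{i=1}^N c_i\,\sigma(\lambda_i x+\theta_i)$ (with $N$ depending on $\varepsilon$) satisfying $\|f-g\|_{C^0([a,b])}<\varepsilon$. Spaces of continuous functions carry the sup norm; $C^0(U,V)$ denotes the continuous maps $U\to V$ with the sup norm, and continuity of $\alpha\mapsto G[\alpha]$ is as a map $W\to C^0(U,V)$. The $L^\infty(W\times U\times\Omega_V)$ norm is the supremum over $(\alpha,u,x)\in W\times U\times\Omega_V$. (MONet) form: for positive integers $M,N,P,m,p$, real constants $c_{kij},\zeta_k,\xi_{kil},\varphi_{kijh},\rho_{kij},\theta_{ki}$, vectors $\omega_k\in\mathbb{R}^n$ and sample points $x_l\in\Omega_U$, $z_h\in\Omega_W$ ($1\le i\le M$, $1\le k\le N$, $1\le j\le P$, $1\le h\le p$, $1\le l\le m$), $$\mathrm{MONet}[\alpha][u](x)=\sum_{k=1}^N\sum_{i=1}^M \tau_k(x)\,b_{ki}(u)\,L_{ki}(\alpha),$$ with $\tau_k(x)=\sigma(\omega_k\cdot x+\zeta_k)$, $b_{ki}(u)=\sigma\big(\sum_{l=1}^m\xi_{kil}u(x_l)+\theta_{ki}\big)$, $L_{ki}(\alpha)=\sum_{j=1}^P c_{kij}\,\sigma\big(\sum_{h=1}^p\varphi_{kijh}\alpha(z_h)+\rho_{kij}\big)$. (MNO) form: for positive integers $P$ and $H^{(p)}$,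 $1\le p\le P$, $$\mathrm{MNO}[\alpha][u](x)=\sum_{p=1}^{P}\sum_{k=1}^{H^{(p)}} l_p(\alpha)\,b_{pk}(u)\,\tau_{pk}(x),$$ where here the components $l_p$, $b_{pk}$, $\tau_{pk}$ have the same structure as $L_{ki}$, $b_{ki}$, $\tau_k$ in the MONet form: each $l_p$ is a finite sum $\sum_j c_{j}\sigma(\sum_h\varphi_{jh}\alpha(z_h)+\rho_j)$, each $b_{pk}$ is $\sigma(\sum_l\xi_l u(x_l)+\theta)$, and each $\tau_{pk}$ is $\sigma(\omega\cdot x+\zeta)$, with parameters depending on the indices. Discretizations: $\boldsymbol{\alpha}=(\alpha(z_h))_h$ and $\mathbf{u}=(u(x_l))_l$ are the vectors of values of $\alpha$ and $u$ at finitely many sample points of $\Omega_W$ and $\Omega_U$ respectively; the networks depend on $\alpha$ and $u$ only through these vectors. *)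

theory Defs
  imports "HOL-Analysis.Analysis"
begin

text \<open>The sup norm takes values in \<^typ>\<open>ennreal\<close>: an activation function need not be continuous or
  locally bounded, so suprema involving it may be infinite. The supremum over the empty set is 0.\<close>

definition sup_norm_on :: "'s set \<Rightarrow> ('s \<Rightarrow> real) \<Rightarrow> ennreal" where
  "sup_norm_on S f = (SUP s\<in>S. ennreal \<bar>f s\<bar>)"

definition tauber_wiener :: "(real \<Rightarrow> real) \<Rightarrow> bool" where
  "tauber_wiener \<sigma> \<longleftrightarrow>
     (\<forall>a b \<epsilon> f. a < b \<longrightarrow> 0 < \<epsilon> \<longrightarrow> continuous_on {a..b} f \<longrightarrow>
        (\<exists>(N::nat) c s \<theta>.
           sup_norm_on {a..b} (\<lambda>x. f x - (\<Sum>i=1..N. c i * \<sigma> (s i * x + \<theta> i))) < ennreal \<epsilon>))"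

text \<open>Points of the space are functions that are extensional, i.e. \<^const>\<open>undefined\<close> outside \<open>K\<close>. The
  boundedness built into \<^const>\<open>cfunspace\<close> is automatic for compact \<open>K\<close>.\<close>

abbreviation C0 :: "'a::topological_space set \<Rightarrow> ('a \<Rightarrow> real) metric" where
  "C0 K \<equiv> cfunspace (top_of_set K) euclidean_metric"

text \<open>The space of continuous maps from a subset \<open>U\<close> of one metric space to another metric space,
  with the sup metric.\<close>

abbreviation C0_maps :: "'a metric \<Rightarrow> 'a set \<Rightarrow> 'b metric \<Rightarrow> ('a \<Rightarrow> 'b) metric" where
  "C0_maps A U B \<equiv> cfunspace (subtopology (mtopology_of A) U) B"

text \<open>Networks act on the vectors \<open>a\<close> (entries 1 to \<open>p\<close>) and \<open>v\<close> (entries 1 to \<open>m\<close>) of sampled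
  values; entries outside these ranges are never read.\<close>

definition trunk :: "(real \<Rightarrow> real) \<Rightarrow> real ^ 'n \<Rightarrow> real \<Rightarrow> real ^ 'n \<Rightarrow> real" where
  "trunk \<sigma> \<omega> \<zeta> x = \<sigma> (\<omega> \<bullet> x + \<zeta>)"

definition branch :: "(real \<Rightarrow> real) \<Rightarrow> nat \<Rightarrow> (nat \<Rightarrow> real) \<Rightarrow> real \<Rightarrow> (nat \<Rightarrow> real) \<Rightarrow> real" where
  "branch \<sigma> m \<xi> \<theta> v = \<sigma> ((\<Sum>l=1..m. \<xi> l * v l) + \<theta>)"

definition param_branch ::
  "(real \<Rightarrow> real) \<Rightarrow> nat \<Rightarrow> nat \<Rightarrow> (nat \<Rightarrow> real) \<Rightarrow> (nat \<Rightarrow> nat \<Rightarrow> real) \<Rightarrow> (nat \<Rightarrow> real) \<Rightarrow>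
     (nat \<Rightarrow> real) \<Rightarrow> real" where
  "param_branch \<sigma> p P c \<phi> \<rho> a = (\<Sum>j=1..P. c j * \<sigma> ((\<Sum>h=1..p. \<phi> j h * a h) + \<rho> j))"

definition is_MONet ::
  "(real \<Rightarrow> real) \<Rightarrow> nat \<Rightarrow> nat \<Rightarrow> ((nat \<Rightarrow> real) \<Rightarrow> (nat \<Rightarrow> real) \<Rightarrow> real ^ 'n \<Rightarrow> real) \<Rightarrow> bool" where
  "is_MONet \<sigma> p m NN \<longleftrightarrow> 0 < p \<and> 0 < m \<and>
     (\<exists>(M::nat) (N::nat) (P::nat) c \<phi> \<rho> \<xi> \<theta> \<omega> \<zeta>. 0 < M \<and> 0 < N \<and> 0 < P \<and>
        NN = (\<lambda>a v x. \<Sum>k=1..N. \<Sum>i=1..M.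
                 trunk \<sigma> (\<omega> k) (\<zeta> k) x *
                 branch \<sigma> m (\<xi> k i) (\<theta> k i) v *
                 param_branch \<sigma> p P (c k i) (\<phi> k i) (\<rho> k i) a))"

text \<open>In the following, \<open>Q\<close> is the number of outer terms, \<open>H q\<close> that of inner terms, and \<open>J q\<close> the
  number of neurons of the component acting on \<open>a\<close>.\<close>

definition is_MNO ::
  "(real \<Rightarrow> real) \<Rightarrow> nat \<Rightarrow> nat \<Rightarrow> ((nat \<Rightarrow> real) \<Rightarrow> (nat \<Rightarrow> real) \<Rightarrow> real ^ 'n \<Rightarrow> real) \<Rightarrow> bool" where
  "is_MNO \<sigma> p m NN \<longleftrightarrow> 0 < p \<and> 0 < m \<and>
     (\<exists>(Q::nat) (H::nat \<Rightarrow> nat) (J::nat \<Rightarrow> nat) c \<phi> \<rho> \<xi> \<theta> \<omega> \<zeta>.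
        0 < Q \<and> (\<forall>q\<in>{1..Q}. 0 < H q \<and> 0 < J q) \<and>
        NN = (\<lambda>a v x. \<Sum>q=1..Q. \<Sum>k=1..H q.
                 param_branch \<sigma> p (J q) (c q) (\<phi> q) (\<rho> q) a *
                 branch \<sigma> m (\<xi> q k) (\<theta> q k) v *
                 trunk \<sigma> (\<omega> q k) (\<zeta> q k) x))"

text \<open>The error when \<open>\<alpha>\<close> is sampled at the points \<open>z h\<close> and \<open>u\<close> at the points \<open>y l\<close>.\<close>

definition network_error ::
  "('a \<Rightarrow> real) set \<Rightarrow> ('u \<Rightarrow> real) set \<Rightarrow> 'x set \<Rightarrow>
   (('a \<Rightarrow> real) \<Rightarrow> ('u \<Rightarrow> real) \<Rightarrow> 'x \<Rightarrow> real) \<Rightarrow>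
   ((nat \<Rightarrow> real) \<Rightarrow> (nat \<Rightarrow> real) \<Rightarrow> 'x \<Rightarrow> real) \<Rightarrow> (nat \<Rightarrow> 'a) \<Rightarrow> (nat \<Rightarrow> 'u) \<Rightarrow> ennreal" where
  "network_error W U \<Omega>V G NN z y =
     sup_norm_on (W \<times> U \<times> \<Omega>V) (\<lambda>(\<alpha>, u, x). G \<alpha> u x - NN (\<lambda>h. \<alpha> (z h)) (\<lambda>l. u (y l)) x)"

end

theory Submission
  imports Defs
begin

text \<open>Sampling \<open>\<alpha>\<close> and \<open>u\<close> along dense sequences of points is injective and continuous, so it maps the
  compact space \<open>W \<times> U \<times> \<Omega>V\<close> homeomorphically onto a compact set \<open>S\<close> of triples \<open>(a, v, x)\<close>, and
  \<open>G \<alpha> u x\<close> becomes a continuous function on \<open>S\<close>. The functions \<open>exp (\<phi> \<cdot> a + \<xi> \<cdot> v + \<omega> \<cdot> x)\<close>, with \<open>\<phi>\<close>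
  and \<open>\<xi>\<close> finitely supported, span an algebra that separates the points of \<open>S\<close>, hence is dense by
  Stone-Weierstrass. Each of them is a product of one exponential in \<open>a\<close>, one in \<open>v\<close> and one in \<open>x\<close>;
  replacing the exponential function, on a bounded interval, by a combination of shifted and scaled
  copies of \<open>\<sigma>\<close> and multiplying out gives a sum of products of three neurons, which is a network of both
  forms.\<close>

section \<open>Finite sums of functions from a given set\<close>

text \<open>Closed under addition only: the generating sets to which it is applied contain their
  scalar multiples, so the hull is their linear span and no coefficients need to be carried through
  inductions.\<close>

inductive_set add_hull :: "('s \<Rightarrow> real) set \<Rightarrow> ('s \<Rightarrow> real) set"
  for B where
    zero: "(\<lambda>_. 0) \<in> add_hull B"
  | incl: "f \<in> B \<Longrightarrow> f \<in> add_hull B"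
  | add: "f \<in> add_hull B \<Longrightarrow> g \<in> add_hull B \<Longrightarrow> (\<lambda>s. f s + g s) \<in> add_hull B"

lemma add_hull_sum:
  "finite I \<Longrightarrow> (\<And>i. i \<in> I \<Longrightarrow> f i \<in> add_hull B) \<Longrightarrow> (\<lambda>s. \<Sum>i\<in>I. f i s) \<in> add_hull B"
  by (induction I rule: finite_induct) (auto intro: add_hull.intros)

lemma add_hull_mono:
  assumes "A \<subseteq> B"
  shows "add_hull A \<subseteq> add_hull B"
proof
  fix f assume "f \<in> add_hull A"
  then show "f \<in> add_hull B"
    using assms by induction (auto intro: add_hull.intros)
qed

text \<open>Distributivity reduces the product to generators: the outer induction splits
  \<open>f\<close>, the inner one splits \<open>g\<close> against a fixed generator
  \<open>a\<close>.\<close>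

lemma add_hull_mult:
  assumes f: "f \<in> add_hull A" and g: "g \<in> add_hull B"
    and prod: "\<And>a b. a \<in> A \<Longrightarrow> b \<in> B \<Longrightarrow> (\<lambda>s. a s * b s) \<in> add_hull C"
  shows "(\<lambda>s. f s * g s) \<in> add_hull C"
  using f
proof induction
  case (incl a)
  from g show ?case
  proof induction
    case (incl b)
    then show ?case using \<open>a \<in> A\<close> prod by blast
  qed (auto simp: distrib_left intro: add_hull.intros)
qed (auto simp: distrib_right intro: add_hull.intros)

text \<open>Networks have a positive number of summands, so the empty sum is rewritten as one zero
  summand, which \<open>zB\<close> provides. Membership of \<open>t i\<close> for every
  \<open>i\<close>, also beyond \<open>N\<close>, later allows the parameters to be chosen as total
  functions of \<open>i\<close>.\<close>

lemma add_hull_repr: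
  assumes "f \<in> add_hull B" and zB: "(\<lambda>_. 0) \<in> B"
  shows "\<exists>N>0. \<exists>t. (\<forall>i. t i \<in> B) \<and> f = (\<lambda>s. \<Sum>i=1..N::nat. t i s)"
  using assms(1)
proof induction
  case zero
  show ?case using zB by (intro exI[of _ 1] conjI exI[of _ "\<lambda>_ _. 0"]) auto
next
  case (incl f)
  then show ?case by (intro exI[of _ 1] conjI exI[of _ "\<lambda>_. f"]) auto
next
  case (add f g)
  then obtain N M t r where N: "N > 0" "M > 0" "\<forall>i. t i \<in> B" "\<forall>i. r i \<in> B"
    and f: "f = (\<lambda>s. \<Sum>i=1..N::nat. t i s)" and g: "g = (\<lambda>s. \<Sum>i=1..M::nat. r i s)"
    by metis
  define w where "w i = (if i \<le> N then t i else r (i - N))" for i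
  have "(\<Sum>i=1..N + M. w i s) = f s + g s" for s
  proof -
    have "(\<Sum>i=1..N + M. w i s) = (\<Sum>i=1..N. w i s) + (\<Sum>i=N+1..N + M. w i s)"
      by (rule sum.ub_add_nat) simp
    also have "(\<Sum>i=N+1..N + M. w i s) = (\<Sum>i=1..M. w (i + N) s)"
      using sum.shift_bounds_cl_nat_ivl[of "\<lambda>i. w i s" 1 N M] by (simp add: add.commute)
    finally show ?thesis by (simp add: w_def f g)
  qed
  then show ?case using N
    by (intro exI[of _ "N + M"] conjI exI[of _ w]) (auto simp: w_def)
qed

section \<open>Uniform approximation by finite sums\<close>

definition approximable :: "'s set \<Rightarrow> ('s \<Rightarrow> real) set \<Rightarrow> ('s \<Rightarrow> real) \<Rightarrow> bool" where
  "approximable S B f \<longleftrightarrow> (\<forall>e>0. \<exists>g\<in>add_hull B. \<forall>s\<in>S. \<bar>f s - g s\<bar> < e)"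

lemma approximable_mono: "approximable S A f \<Longrightarrow> A \<subseteq> B \<Longrightarrow> approximable S B f"
  unfolding approximable_def using add_hull_mono by blast

text \<open>Transitivity of approximation. The induction hypotheses hold for every error bound, so
  each addition can simply ask for half the error.\<close>

lemma approximable_add_hull:
  assumes "f \<in> add_hull A" and A: "\<And>a. a \<in> A \<Longrightarrow> approximable S B a"
  shows "approximable S B f"
  using assms(1)
proof induction
  case zero
  show ?case by (auto simp: approximable_def intro!: bexI[of _ "\<lambda>_. 0"] add_hull.zero)
next
  case (incl a)
  then show ?case by (rule A)
next
  case (add f g)
  show ?case unfolding approximable_def
  proof (intro allI impI)
    fix e :: real assume "e > 0"
    then have "e / 2 > 0" by simp
    with add.IH obtain f' g' where fg: "f' \<in> add_hull B" "\<forall>s\<in>S. \<bar>f s - f' s\<bar> < e / 2"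
      "g' \<in> add_hull B" "\<forall>s\<in>S. \<bar>g s - g' s\<bar> < e / 2"
      unfolding approximable_def by meson
    have "\<bar>f s + g s - (f' s + g' s)\<bar> < e" if "s \<in> S" for s
    proof -
      from fg that have "\<bar>f s - f' s\<bar> < e / 2" "\<bar>g s - g' s\<bar> < e / 2" by auto
      then show ?thesis by linarith
    qed
    with fg show "\<exists>h\<in>add_hull B. \<forall>s\<in>S. \<bar>f s + g s - h s\<bar> < e"
      by (intro bexI[of _ "\<lambda>s. f' s + g' s"]) (auto intro: add_hull.add)
  qed
qed

text \<open>The error splits as \<open>f * (g - g') + (f - f') * g'\<close>; boundedness of
  \<open>f\<close> and \<open>g\<close> on \<open>S\<close> controls both terms.\<close>

lemma approximable_mult:
  assumes f: "approximable S A f" and g: "approximable S B g"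
    and bf: "bounded (f ` S)" and bg: "bounded (g ` S)"
  shows "approximable S {\<lambda>s. a s * b s |a b. a \<in> A \<and> b \<in> B} (\<lambda>s. f s * g s)"
  unfolding approximable_def
proof (intro allI impI)
  fix e :: real assume e: "e > 0"
  obtain K where K: "K > 0" "\<And>s. s \<in> S \<Longrightarrow> \<bar>f s\<bar> \<le> K"
    using bf unfolding bounded_pos by auto
  obtain L where L: "L > 0" "\<And>s. s \<in> S \<Longrightarrow> \<bar>g s\<bar> \<le> L"
    using bg unfolding bounded_pos by auto
  \<comment> \<open>The bound 1 gives \<open>\<bar>g' s\<bar> \<le> L + 1\<close>; the quotient
    makes the two error terms \<open>K * d\<close> and \<open>d * (L + 1)\<close> add up to at most
    \<open>e\<close>.\<close>
  define d where "d = min 1 (e / (K + L + 1))"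
  have d: "d > 0" "d \<le> 1"
    using e K L by (auto simp: d_def)
  have "d \<le> e / (K + L + 1)" by (simp add: d_def)
  then have dKL: "d * (K + L + 1) \<le> e"
    using K(1) L(1) by (simp add: pos_le_divide_eq)
  obtain f' where f': "f' \<in> add_hull A" "\<forall>s\<in>S. \<bar>f s - f' s\<bar> < d"
    using f d unfolding approximable_def by blast
  obtain g' where g': "g' \<in> add_hull B" "\<forall>s\<in>S. \<bar>g s - g' s\<bar> < d"
    using g d unfolding approximable_def by blast
  have hull: "(\<lambda>s. f' s * g' s) \<in> add_hull {\<lambda>s. a s * b s |a b. a \<in> A \<and> b \<in> B}"
    using f'(1) g'(1) by (rule add_hull_mult) (auto intro: add_hull.incl)
  have "\<bar>f s * g s - f' s * g' s\<bar> < e" if "s \<in> S" for s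
  proof -
    have 1: "\<bar>f s - f' s\<bar> < d" "\<bar>g s - g' s\<bar> < d" using f' g' that by auto
    then have 2: "\<bar>g' s\<bar> \<le> L + 1" using L(2)[OF that] d by linarith
    have "f s * g s - f' s * g' s = f s * (g s - g' s) + (f s - f' s) * g' s"
      by (simp add: algebra_simps)
    then have "\<bar>f s * g s - f' s * g' s\<bar> \<le> \<bar>f s\<bar> * \<bar>g s - g' s\<bar> + \<bar>f s - f' s\<bar> * \<bar>g' s\<bar>"
      by (metis abs_mult abs_triangle_ineq)
    also have "\<bar>f s\<bar> * \<bar>g s - g' s\<bar> \<le> K * d"
      using 1 K(2)[OF that] by (intro mult_mono) auto
    also have "\<bar>f s - f' s\<bar> * \<bar>g' s\<bar> \<le> \<bar>f s - f' s\<bar> * (L + 1)"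
      using 2 by (rule mult_left_mono) simp
    also have "\<dots> < d * (L + 1)"
      using 1 L(1) by (intro mult_strict_right_mono) auto
    finally show ?thesis using dKL by (simp add: algebra_simps)
  qed
  with hull show "\<exists>h\<in>add_hull {\<lambda>s. a s * b s |a b. a \<in> A \<and> b \<in> B}. \<forall>s\<in>S. \<bar>f s * g s - h s\<bar> < e"
    by (intro bexI ballI)
qed

section \<open>The sup norm and approximation by the activation function\<close>

lemma sup_norm_on_less_imp:
  assumes "sup_norm_on S f < ennreal e" "s \<in> S"
  shows "\<bar>f s\<bar> < e"
proof -
  have "ennreal \<bar>f s\<bar> < ennreal e"
    using assms unfolding sup_norm_on_def by (rule SUP_lessD)
  then show ?thesis by (simp add: ennreal_less_iff)
qed

text \<open>The bound \<open>e / 2\<close> leaves room for the supremum, which could otherwise reach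
  \<open>e\<close>.\<close>

lemma sup_norm_on_less:
  assumes "0 < e" "\<And>s. s \<in> S \<Longrightarrow> \<bar>f s\<bar> \<le> e / 2"
  shows "sup_norm_on S f < ennreal e"
proof -
  have "sup_norm_on S f \<le> ennreal (e / 2)"
    unfolding sup_norm_on_def using assms by (intro SUP_least ennreal_leI) auto
  also have "\<dots> < ennreal e"
    using assms(1) by (simp add: ennreal_less_iff)
  finally show ?thesis .
qed

text \<open>The function \<open>l\<close> maps the compact set into a bounded interval, on which the
  one-dimensional approximation of \<open>h\<close> is uniform; composing with \<open>l\<close>
  transfers it to \<open>S\<close>.\<close>

lemma tauber_wiener_approximable:
  assumes \<sigma>: "tauber_wiener \<sigma>" and S: "compact S" and l: "continuous_on S l"
    and h: "continuous_on UNIV h"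
  shows "approximable S {\<lambda>s. c * \<sigma> (r * l s + t) |c r t. True} (\<lambda>s. h (l s))"
  unfolding approximable_def
proof (intro allI impI)
  fix e :: real assume e: "e > 0"
  have "bounded (l ` S)"
    using S l compact_continuous_image compact_imp_bounded by blast
  \<comment> \<open>\<open>K > 0\<close>, available even for empty \<open>S\<close>, makes
    \<open>{-K..K}\<close> a nondegenerate interval, as \<open>tauber_wiener\<close>
    demands.\<close>
  then obtain K where K: "K > 0" "\<And>s. s \<in> S \<Longrightarrow> \<bar>l s\<bar> \<le> K"
    unfolding bounded_pos by auto
  obtain N c r \<theta> where
    *: "sup_norm_on {-K..K} (\<lambda>x. h x - (\<Sum>i=1..N::nat. c i * \<sigma> (r i * x + \<theta> i))) < ennreal e"
    using \<sigma>[unfolded tauber_wiener_def, rule_format, of "-K" K e h] K(1) e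
      continuous_on_subset[OF h subset_UNIV] by auto
  have hull: "(\<lambda>s. \<Sum>i=1..N. c i * \<sigma> (r i * l s + \<theta> i)) \<in> add_hull {\<lambda>s. c * \<sigma> (r * l s + t) |c r t. True}"
    by (rule add_hull_sum) (auto intro!: add_hull.incl)
  have "\<bar>h (l s) - (\<Sum>i=1..N. c i * \<sigma> (r i * l s + \<theta> i))\<bar> < e" if "s \<in> S" for s
    using sup_norm_on_less_imp[OF *, of "l s"] K(2)[OF that] by (simp add: abs_le_iff)
  with hull show "\<exists>g\<in>add_hull {\<lambda>s. c * \<sigma> (r * l s + t) |c r t. True}. \<forall>s\<in>S. \<bar>h (l s) - g s\<bar> < e"
    by (intro bexI ballI)
qed

section \<open>Exponentials and products of neurons\<close>

text \<open>The coefficient \<open>c\<close> makes \<open>exps p\<close> closed under scaling. The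
  sums start at 1 to match the indexing of network inputs, so entry 0 of \<open>a\<close> and
  \<open>v\<close> is never read.\<close>

definition exp_term :: "nat \<Rightarrow> real \<Rightarrow> (nat \<Rightarrow> real) \<Rightarrow> (nat \<Rightarrow> real) \<Rightarrow> real ^ 'n \<Rightarrow>
    (nat \<Rightarrow> real) \<times> (nat \<Rightarrow> real) \<times> (real ^ 'n) \<Rightarrow> real" where
  "exp_term p c \<phi> \<xi> \<omega> = (\<lambda>(a, v, x).
     c * exp ((\<Sum>h=1..p. \<phi> h * a h) + (\<Sum>h=1..p. \<xi> h * v h) + \<omega> \<bullet> x))"

definition exps :: "nat \<Rightarrow> ((nat \<Rightarrow> real) \<times> (nat \<Rightarrow> real) \<times> (real ^ 'n) \<Rightarrow> real) set" where
  "exps p = {exp_term p c \<phi> \<xi> \<omega> |c \<phi> \<xi> \<omega>. True}"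

text \<open>The common summand of both network forms: the factor \<open>c * \<sigma> (...)\<close>
  is a \<open>param_branch\<close> with a single neuron.\<close>

definition neuron_product :: "(real \<Rightarrow> real) \<Rightarrow> nat \<Rightarrow> real \<Rightarrow> (nat \<Rightarrow> real) \<Rightarrow> real \<Rightarrow> (nat \<Rightarrow> real) \<Rightarrow> real \<Rightarrow>
    real ^ 'n \<Rightarrow> real \<Rightarrow> (nat \<Rightarrow> real) \<times> (nat \<Rightarrow> real) \<times> (real ^ 'n) \<Rightarrow> real" where
  "neuron_product \<sigma> p c \<phi> \<rho> \<xi> \<theta> \<omega> \<zeta> = (\<lambda>(a, v, x).
     c * \<sigma> ((\<Sum>h=1..p. \<phi> h * a h) + \<rho>) * branch \<sigma> p \<xi> \<theta> v * trunk \<sigma> \<omega> \<zeta> x)"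

definition neuron_products ::
  "(real \<Rightarrow> real) \<Rightarrow> nat \<Rightarrow> ((nat \<Rightarrow> real) \<times> (nat \<Rightarrow> real) \<times> (real ^ 'n) \<Rightarrow> real) set" where
  "neuron_products \<sigma> p = {neuron_product \<sigma> p c \<phi> \<rho> \<xi> \<theta> \<omega> \<zeta> |c \<phi> \<rho> \<xi> \<theta> \<omega> \<zeta>. True}"

lemma continuous_on_linear_samples:
  fixes f :: "'s::topological_space \<Rightarrow> nat \<Rightarrow> real"
  assumes "continuous_on S f"
  shows "continuous_on S (\<lambda>s. \<Sum>h=1..p. \<phi> h * f s h)"
  by (intro continuous_on_sum continuous_on_mult_left continuous_on_product_then_coordinatewise[OF assms])

text \<open>The exponential of a sum factors into exponentials of the three continuous functions
  \<open>la\<close>, \<open>lv\<close> and \<open>lx\<close> on \<open>S\<close>, so approximating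
  the one-variable exponential three times suffices.\<close>

lemma exps_approximable:
  fixes f :: "(nat \<Rightarrow> real) \<times> (nat \<Rightarrow> real) \<times> (real ^ 'n) \<Rightarrow> real"
  assumes \<sigma>: "tauber_wiener \<sigma>" and S: "compact S" and f: "f \<in> exps p"
  shows "approximable S (neuron_products \<sigma> p) f"
proof -
  obtain c \<phi> \<xi> \<omega> where f: "f = exp_term p c \<phi> \<xi> \<omega>"
    using f unfolding exps_def by blast
  define la :: "(nat \<Rightarrow> real) \<times> (nat \<Rightarrow> real) \<times> (real ^ 'n) \<Rightarrow> real" where
    "la s = (\<Sum>h=1..p. \<phi> h * fst s h)" for s
  define lv :: "(nat \<Rightarrow> real) \<times> (nat \<Rightarrow> real) \<times> (real ^ 'n) \<Rightarrow> real" where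
    "lv s = (\<Sum>h=1..p. \<xi> h * fst (snd s) h)" for s
  define lx :: "(nat \<Rightarrow> real) \<times> (nat \<Rightarrow> real) \<times> (real ^ 'n) \<Rightarrow> real" where
    "lx s = \<omega> \<bullet> snd (snd s)" for s
  have cont: "continuous_on S la" "continuous_on S lv" "continuous_on S lx"
    unfolding la_def lv_def lx_def
    by (intro continuous_on_linear_samples continuous_on_inner continuous_on_const
        continuous_on_fst continuous_on_snd continuous_on_id)+
  have bd: "bounded (g ` S)" if "continuous_on S g" for g :: "_ \<Rightarrow> real"
    using S that compact_continuous_image compact_imp_bounded by blast
  let ?A = "\<lambda>l. {\<lambda>s. c * \<sigma> (r * l s + t) |c r t. True}"
  let ?P = "\<lambda>A B. {\<lambda>s. a s * b s |a b. a \<in> A \<and> b \<in> B}"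
  \<comment> \<open>The factor \<open>k\<close> lets the first exponential absorb the coefficient
    \<open>c\<close>; the other two use \<open>k = 1\<close>.\<close>
  have approx: "approximable S (?A l) (\<lambda>s. k * exp (l s))" if "continuous_on S l" for k l
    by (rule tauber_wiener_approximable[OF \<sigma> S that, of "\<lambda>t. k * exp t"]) (intro continuous_intros)
  have bd_exp: "bounded ((\<lambda>s. c * exp (la s)) ` S)" "bounded ((\<lambda>s. exp (lv s)) ` S)"
    "bounded ((\<lambda>s. exp (lx s)) ` S)" "bounded ((\<lambda>s. c * exp (la s) * exp (lv s)) ` S)"
    by (rule bd, intro continuous_on_mult continuous_on_exp continuous_on_const cont)+
  have "approximable S (?P (?P (?A la) (?A lv)) (?A lx)) (\<lambda>s. c * exp (la s) * exp (lv s) * exp (lx s))"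
    using approximable_mult[OF approximable_mult[OF approx[OF cont(1), of c]
      approx[OF cont(2), of 1, unfolded mult_1] bd_exp(1,2)]
      approx[OF cont(3), of 1, unfolded mult_1] bd_exp(4,3)] .
  then have "approximable S (neuron_products \<sigma> p) (\<lambda>s. c * exp (la s) * exp (lv s) * exp (lx s))"
  proof (rule approximable_mono, safe)
    fix c1 r1 t1 c2 r2 t2 c3 r3 t3 :: real
    \<comment> \<open>The inner factors \<open>r1\<close>, \<open>r2\<close>, \<open>r3\<close> go
      into the weights, and the three outer coefficients merge into one.\<close>
    have "(\<lambda>s. c1 * \<sigma> (r1 * la s + t1) * (c2 * \<sigma> (r2 * lv s + t2)) * (c3 * \<sigma> (r3 * lx s + t3))) =
      neuron_product \<sigma> p (c1 * c2 * c3) (\<lambda>h. r1 * \<phi> h) t1 (\<lambda>h. r2 * \<xi> h) t2 (r3 *\<^sub>R \<omega>) t3"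
      by (auto simp: fun_eq_iff neuron_product_def la_def lv_def lx_def branch_def trunk_def sum_distrib_left mult_ac)
    then show "(\<lambda>s. c1 * \<sigma> (r1 * la s + t1) * (c2 * \<sigma> (r2 * lv s + t2)) * (c3 * \<sigma> (r3 * lx s + t3)))
        \<in> neuron_products \<sigma> p"
      unfolding neuron_products_def by blast
  qed
  also have "(\<lambda>s. c * exp (la s) * exp (lv s) * exp (lx s)) = f"
    by (auto simp: fun_eq_iff f exp_term_def la_def lv_def lx_def exp_add)
  finally show ?thesis .
qed

text \<open>Weights are padded with zeros. The families thus form an increasing chain, so two
  elements always fit in a common one.\<close>

lemma exps_mono:
  assumes "p \<le> q"
  shows "exps p \<subseteq> exps q"
proof
  fix f :: "(nat \<Rightarrow> real) \<times> (nat \<Rightarrow> real) \<times> (real ^ 'n) \<Rightarrow> real"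
  assume "f \<in> exps p"
  then obtain c \<phi> \<xi> \<omega> where f: "f = exp_term p c \<phi> \<xi> \<omega>"
    unfolding exps_def by blast
  have "(\<Sum>h=1..q. (if h \<le> p then \<psi> h else 0) * a h) = (\<Sum>h=1..p. \<psi> h * a h)" for \<psi> a :: "nat \<Rightarrow> real"
    using assms by (intro sum.mono_neutral_cong_right) auto
  then have "f = exp_term q c (\<lambda>h. if h \<le> p then \<phi> h else 0) (\<lambda>h. if h \<le> p then \<xi> h else 0) \<omega>"
    by (simp only: f exp_term_def)
  then show "f \<in> exps q"
    unfolding exps_def by blast
qed

text \<open>Exponents add under multiplication, which turns the span into an algebra.\<close>

lemma exps_mult:
  assumes "f \<in> exps p" "g \<in> exps p"
  shows "(\<lambda>s. f s * g s) \<in> exps p"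
proof -
  obtain c \<phi> \<xi> \<omega> where f: "f = exp_term p c \<phi> \<xi> \<omega>"
    using assms(1) unfolding exps_def by blast
  obtain c' \<phi>' \<xi>' \<omega>' where g: "g = exp_term p c' \<phi>' \<xi>' \<omega>'"
    using assms(2) unfolding exps_def by blast
  have "(\<lambda>s. f s * g s) = exp_term p (c * c') (\<lambda>h. \<phi> h + \<phi>' h) (\<lambda>h. \<xi> h + \<xi>' h) (\<omega> + \<omega>')"
    by (auto simp: fun_eq_iff f exp_term_def g distrib_right sum.distrib inner_add_left exp_add)
  then show ?thesis
    unfolding exps_def by blast
qed

lemma exps_continuous:
  assumes "f \<in> exps p"
  shows "continuous_on S f"
proof -
  obtain c \<phi> \<xi> \<omega> where f: "f = exp_term p c \<phi> \<xi> \<omega>"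
    using assms(1) unfolding exps_def by blast
  show ?thesis unfolding f exp_term_def case_prod_unfold
    by (intro continuous_on_mult continuous_on_const continuous_on_exp continuous_on_add
        continuous_on_inner continuous_on_linear_samples continuous_on_fst continuous_on_snd continuous_on_id)
qed

section \<open>Density of the exponentials\<close>

text \<open>Stone-Weierstrass for the union \<open>R\<close> of the spans over all \<open>p\<close>.
  Exponents ignore entry 0, so \<open>coord\<close> is what prevents two points of \<open>S\<close>
  from differing there alone.\<close>

lemma exps_dense:
  fixes S :: "((nat \<Rightarrow> real) \<times> (nat \<Rightarrow> real) \<times> (real ^ 'n)) set"
  assumes S: "compact S" and F: "continuous_on S F" and e: "e > 0"
    and coord: "\<And>a v x. (a, v, x) \<in> S \<Longrightarrow> a 0 = a 1 \<and> v 0 = v 1"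
  shows "\<exists>p>0. \<exists>g\<in>add_hull (exps p). \<forall>s\<in>S. \<bar>F s - g s\<bar> < e"
proof -
  define R :: "((nat \<Rightarrow> real) \<times> (nat \<Rightarrow> real) \<times> (real ^ 'n) \<Rightarrow> real) set" where
    "R = (\<Union>p. add_hull (exps p))"
  have mono: "add_hull (exps p) \<subseteq> add_hull (exps (max p q))"
    "add_hull (exps q) \<subseteq> add_hull (exps (max p q))" for p q :: nat
    by (intro add_hull_mono exps_mono; simp)+
  have common: "\<exists>p. f \<in> add_hull (exps p) \<and> g \<in> add_hull (exps p)" if "f \<in> R" "g \<in> R" for f g
    using that mono unfolding R_def by blast
  have exps: "exp_term p c \<phi> \<xi> \<omega> \<in> R" for c \<phi> \<xi> \<omega> p
    unfolding R_def exps_def by (intro UN_I[of p] add_hull.incl) blast+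
  interpret function_ring_on R S
  proof
    show "compact S" by (rule S)
    show "continuous_on S f" if f: "f \<in> R" for f
    proof -
      obtain p where "f \<in> add_hull (exps p)" using f unfolding R_def by blast
      then show ?thesis
        by induction (auto intro: continuous_intros exps_continuous)
    qed
    show "(\<lambda>s. f s + g s) \<in> R" if "f \<in> R" "g \<in> R" for f g
      using common[OF that] unfolding R_def by (blast intro: add_hull.add)
    show "(\<lambda>s. f s * g s) \<in> R" if fg: "f \<in> R" "g \<in> R" for f g
    proof -
      obtain p where "f \<in> add_hull (exps p)" "g \<in> add_hull (exps p)"
        using common[OF fg] by blast
      then have "(\<lambda>s. f s * g s) \<in> add_hull (exps p)"
        by (rule add_hull_mult) (intro add_hull.incl exps_mult)
      then show ?thesis unfolding R_def by blast
    qed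
    \<comment> \<open>With \<open>p = 0\<close> and \<open>\<omega> = 0\<close> the exponent
      vanishes, leaving the constant.\<close>
    show "(\<lambda>_. c) \<in> R" for c
      using exps[of 0 c "\<lambda>_. 0" "\<lambda>_. 0" 0] by (simp add: exp_term_def case_prod_unfold)
    show "\<exists>f\<in>R. f s \<noteq> f t" if st: "s \<in> S" "t \<in> S" "s \<noteq> t" for s t
    proof -
      obtain a v x b w y where s: "s = (a, v, x)" and t: "t = (b, w, y)"
        by (metis surj_pair)
      \<comment> \<open>Indicator weights turn the exponent into a single coordinate; injectivity of
        the exponential then separates the points.\<close>
      have sel: "(\<Sum>h=1..k. (if h = k then 1 else 0) * a h) = a k" if "k \<ge> 1" for k :: nat and a :: "nat \<Rightarrow> real"
        using that by (simp add: if_distrib[of "\<lambda>c. c * _"] cong: if_cong)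
      have pos: "\<exists>k\<ge>1. a k \<noteq> b k" if "a \<noteq> b" "a 0 = a 1" "b 0 = b 1" for a b :: "nat \<Rightarrow> real"
      proof -
        obtain k where k: "a k \<noteq> b k" using \<open>a \<noteq> b\<close> by auto
        show ?thesis
        proof (cases "k = 0")
          case True
          then show ?thesis using k that by (intro exI[of _ 1]) simp
        next
          case False
          then show ?thesis using k by (intro exI[of _ k]) simp
        qed
      qed
      consider "a \<noteq> b" | "v \<noteq> w" | "x \<noteq> y" using st(3) s t by auto
      then show ?thesis
      proof cases
        case 1
        then obtain k where "k \<ge> 1" "a k \<noteq> b k" using pos coord st s t by metis
        then show ?thesis
          using sel by (intro bexI[OF _ exps[of k 1 "\<lambda>h. if h = k then 1 else 0" "\<lambda>_. 0" 0]]) (simp add: s t exp_term_def)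
      next
        case 2
        then obtain k where "k \<ge> 1" "v k \<noteq> w k" using pos coord st s t by metis
        then show ?thesis
          using sel by (intro bexI[OF _ exps[of k 1 "\<lambda>_. 0" "\<lambda>h. if h = k then 1 else 0" 0]]) (simp add: s t exp_term_def)
      next
        case 3
        \<comment> \<open>The direction \<open>x - y\<close> works because the two inner products
          differ by \<open>(x - y) \<bullet> (x - y)\<close>, which is nonzero.\<close>
        then have "(x - y) \<bullet> x \<noteq> (x - y) \<bullet> y"
          by (metis inner_diff_right inner_eq_zero_iff right_minus_eq)
        then show ?thesis
          by (intro bexI[OF _ exps[of 0 1 "\<lambda>_. 0" "\<lambda>_. 0" "x - y"]]) (simp add: s t exp_term_def)
      qed
    qed
  qed
  obtain p g where "g \<in> add_hull (exps p)" "\<forall>s\<in>S. \<bar>F s - g s\<bar> < e"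
    using Stone_Weierstrass_basic[OF F e] unfolding R_def by blast
  \<comment> \<open>Passing to \<open>Suc p\<close> secures \<open>p > 0\<close>, which both network
    forms require of their input sizes.\<close>
  moreover from this have "g \<in> add_hull (exps (Suc p))"
    using add_hull_mono[OF exps_mono[of p "Suc p"]] by auto
  ultimately show ?thesis by (intro exI[of _ "Suc p"] conjI bexI) simp_all
qed

section \<open>Sampling continuous functions on compact sets\<close>

text \<open>Total boundedness gives a finite net of radius \<open>inverse (Suc n)\<close> for each
  \<open>n\<close>; the union of these nets is countable, dense and nonempty.\<close>

lemma compact_dense_sequence:
  fixes S :: "'a::metric_space set"
  assumes "compact S" "S \<noteq> {}"
  shows "\<exists>z::nat \<Rightarrow> 'a. range z \<subseteq> S \<and> S \<subseteq> closure (range z)"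
proof -
  have "\<exists>k. finite k \<and> k \<subseteq> S \<and> S \<subseteq> (\<Union>x\<in>k. ball x (inverse (Suc n)))" for n
    using seq_compact_imp_totally_bounded[OF assms(1)[unfolded compact_eq_seq_compact_metric]]
    by simp
  then obtain k where k: "\<And>n. finite (k n)" "\<And>n. k n \<subseteq> S"
    "\<And>n. S \<subseteq> (\<Union>x\<in>k n. ball x (inverse (Suc n)))"
    by metis
  define D where "D = (\<Union>n. k n)"
  have "countable D" using k(1) by (auto simp: D_def intro: countable_finite)
  moreover have "D \<noteq> {}" using k(3)[of 0] assms(2) by (fastforce simp: D_def)
  ultimately have D: "range (from_nat_into D) = D" by (rule range_from_nat_into[rotated])
  have "S \<subseteq> closure D"
  proof (unfold closure_approachable subset_iff, intro allI impI)
    fix s and e :: real assume s: "s \<in> S" and e: "e > 0"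
    obtain n where n: "inverse (Suc n) < e" using reals_Archimedean[OF e] by blast
    obtain y where "y \<in> k n" "dist y s < inverse (Suc n)" using k(3)[of n] s by auto
    then show "\<exists>y\<in>D. dist y s < e" using n unfolding D_def by (intro bexI[of _ y]) auto
  qed
  moreover have "D \<subseteq> S" using k(2) by (auto simp: D_def)
  ultimately show ?thesis using D by metis
qed

text \<open>The sup metric makes the dependence on \<open>x\<close> uniform in \<open>y\<close>:
  first \<open>y\<close> moves at fixed \<open>x\<close> by continuity of \<open>f x\<close>, then
  \<open>x\<close> moves at fixed \<open>y'\<close>, each at cost \<open>e / 2\<close>.\<close>

lemma continuous_map_uncurry:
  assumes f: "continuous_map X (mtopology_of (cfunspace Y m)) f"
  shows "continuous_map (prod_topology X Y) (mtopology_of m) (\<lambda>(x, y). f x y)"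
proof -
  interpret m: Metric_space "mspace m" "mdist m" by simp
  interpret c: Metric_space "mspace (cfunspace Y m)" "mdist (cfunspace Y m)"
    by (rule Metric_space_mspace_mdist)
  have fx: "f x \<in> mspace (cfunspace Y m)" if "x \<in> topspace X" for x
    using continuous_map_funspace[OF f] that by auto
  have "\<exists>U. openin (prod_topology X Y) U \<and> s \<in> U \<and> (\<forall>t\<in>U. (case t of (x, y) \<Rightarrow> f x y) \<in> m.mball (case s of (x, y) \<Rightarrow> f x y) e)"
    if s: "s \<in> topspace (prod_topology X Y)" and e: "e > 0" for s e
  proof -
    obtain x y where [simp]: "s = (x, y)" by fastforce
    have x: "x \<in> topspace X" and y: "y \<in> topspace Y" using s by auto
    have e2: "e / 2 > 0" using e by simp
    obtain U where U: "openin X U" "x \<in> U" "\<And>x'. x' \<in> U \<Longrightarrow> f x' \<in> c.mball (f x) (e / 2)"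
      using f x e2 unfolding mtopology_of_def c.continuous_map_to_metric by meson
    have "continuous_map Y m.mtopology (f x)"
      using fx[OF x] by (simp add: mtopology_of_def)
    then obtain V where V: "openin Y V" "y \<in> V" "\<And>y'. y' \<in> V \<Longrightarrow> f x y' \<in> m.mball (f x y) (e / 2)"
      using y e2 unfolding m.continuous_map_to_metric by meson
    have "f x' y' \<in> m.mball (f x y) e" if "x' \<in> U" "y' \<in> V" for x' y'
    proof -
      have x': "x' \<in> topspace X" and y': "y' \<in> topspace Y"
        using that U(1) V(1) openin_subset by blast+
      have mem: "f x y \<in> mspace m" "f x y' \<in> mspace m" "f x' y' \<in> mspace m"
        using fx[OF x] fx[OF x'] y y' by auto
      have dist: "mdist (cfunspace Y m) (f x) (f x') < e / 2" using U(3)[OF that(1)]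
        unfolding c.in_mball by blast
      have "mdist m (f x y') (f x' y') \<le> mdist (cfunspace Y m) (f x) (f x')"
        using mdist_cfunspace_imp_mdist_le[OF fx[OF x] fx[OF x'] order_refl y'] by simp
      with dist V(3)[OF that(2)] m.triangle[OF mem] mem show ?thesis by simp
    qed
    then show ?thesis
      using U V by (intro exI[of _ "U \<times> V"]) (auto simp: openin_prod_Times_iff)
  qed
  then show ?thesis
    unfolding mtopology_of_def m.continuous_map_to_metric by blast
qed

text \<open>The set where two continuous functions agree is closed in \<open>K\<close> and contains
  a dense set; outside \<open>K\<close> extensionality fixes both values.\<close>

lemma C0_eqI:
  assumes "f \<in> mspace (C0 K)" "g \<in> mspace (C0 K)" "D \<subseteq> K" "K \<subseteq> closure D"
    and eq: "\<And>x. x \<in> D \<Longrightarrow> f x = g x"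
  shows "f = g"
proof (rule extensionalityI)
  show "f \<in> extensional K" "g \<in> extensional K" using assms by auto
  have "continuous_on K f" "continuous_on K g"
    using assms by auto
  then have "closedin (top_of_set K) {x \<in> K. f x - g x = 0}"
    by (intro continuous_closedin_preimage_constant continuous_on_diff)
  then obtain T where T: "closed T" "{x \<in> K. f x - g x = 0} = K \<inter> T"
    unfolding closedin_closed by blast
  then have "D \<subseteq> T" using eq \<open>D \<subseteq> K\<close> by auto
  then have "closure D \<subseteq> T" using T(1) by (rule closure_minimal)
  then show "f x = g x" if "x \<in> K" for x
    using T(2) that \<open>K \<subseteq> closure D\<close> by auto
qed

text \<open>Uncurrying the identity of \<open>C0 K\<close> shows that evaluation is jointly
  continuous; then the point \<open>x\<close> is held fixed.\<close>

lemma continuous_map_sample: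
  assumes "x \<in> K"
  shows "continuous_map (subtopology (mtopology_of (C0 K)) W) euclidean (\<lambda>f. f x)"
proof -
  have "continuous_map (prod_topology (mtopology_of (C0 K)) (top_of_set K)) euclidean (\<lambda>(f, x). f x)"
    using continuous_map_uncurry[of "mtopology_of (C0 K)" "top_of_set K" euclidean_metric "\<lambda>f. f"] by simp
  moreover have "continuous_map (subtopology (mtopology_of (C0 K)) W)
      (prod_topology (mtopology_of (C0 K)) (top_of_set K)) (\<lambda>f. (f, x))"
    using assms by (auto simp: continuous_map_paired continuous_map_from_subtopology)
  ultimately have "continuous_map (subtopology (mtopology_of (C0 K)) W) euclidean ((\<lambda>(f, x). f x) \<circ> (\<lambda>f. (f, x)))"
    by (rule continuous_map_compose[rotated])
  then show ?thesis by (simp add: o_def)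
qed

lemma continuous_map_samples:
  assumes "range z \<subseteq> K"
  shows "continuous_map (subtopology (mtopology_of (C0 K)) W) euclidean (\<lambda>f h. f (z h))"
  unfolding euclidean_product_topology[symmetric] continuous_map_componentwise_UNIV
  using assms by (intro allI continuous_map_sample) auto

text \<open>Uncurrying twice, first over \<open>U\<close> and then over \<open>K\<close>. The
  \<open>restrict\<close> disappears in between because the second component already lies in
  \<open>U\<close>.\<close>

lemma continuous_map_operator:
  assumes "continuous_map (subtopology (mtopology_of A) W) (mtopology_of (C0_maps B U (C0 K)))
      (\<lambda>\<alpha>. restrict (G \<alpha>) U)"
  shows "continuous_map (prod_topology (prod_topology (subtopology (mtopology_of A) W)
      (subtopology (mtopology_of B) U)) (top_of_set K)) euclidean (\<lambda>((\<alpha>, u), x). G \<alpha> u x)"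
proof -
  let ?X = "prod_topology (subtopology (mtopology_of A) W) (subtopology (mtopology_of B) U)"
  have "continuous_map ?X (mtopology_of (C0 K)) (\<lambda>(\<alpha>, u). restrict (G \<alpha>) U u)"
    using continuous_map_uncurry[OF assms] .
  then have "continuous_map ?X (mtopology_of (C0 K)) (\<lambda>s. G (fst s) (snd s))"
    by (rule continuous_map_eq) auto
  from continuous_map_uncurry[OF this] show ?thesis
    by (simp add: case_prod_unfold)
qed

text \<open>A continuous injection of a compact space into a Hausdorff space lets \<open>G\<close>
  descend to the image. This replaces the function spaces by sequences with the product topology,
  the setting of \<open>exps_dense\<close>.\<close>

lemma operator_factors_through_samples:
  fixes zW :: "nat \<Rightarrow> 'a::metric_space" and zU :: "nat \<Rightarrow> 'u::metric_space" and \<Omega>V :: "(real ^ 'n) set"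
  assumes W: "compactin (mtopology_of (C0 \<Omega>W)) W" and U: "compactin (mtopology_of (C0 \<Omega>U)) U"
    and V: "compact \<Omega>V"
    and zW: "range zW \<subseteq> \<Omega>W" "\<Omega>W \<subseteq> closure (range zW)"
    and zU: "range zU \<subseteq> \<Omega>U" "\<Omega>U \<subseteq> closure (range zU)"
    and G: "continuous_map (subtopology (mtopology_of (C0 \<Omega>W)) W)
        (mtopology_of (C0_maps (C0 \<Omega>U) U (C0 \<Omega>V))) (\<lambda>\<alpha>. restrict (G \<alpha>) U)"
  defines "S \<equiv> (\<lambda>((\<alpha>, u), x). (\<lambda>h. \<alpha> (zW h), \<lambda>l. u (zU l), x)) ` ((W \<times> U) \<times> \<Omega>V)"
  shows "compact S"
    and "\<exists>F. continuous_on S F \<and>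
      (\<forall>\<alpha>\<in>W. \<forall>u\<in>U. \<forall>x\<in>\<Omega>V. F (\<lambda>h. \<alpha> (zW h), \<lambda>l. u (zU l), x) = G \<alpha> u x)"
proof -
  let ?W = "subtopology (mtopology_of (C0 \<Omega>W)) W" and ?U = "subtopology (mtopology_of (C0 \<Omega>U)) U"
  let ?X = "prod_topology (prod_topology ?W ?U) (top_of_set \<Omega>V)"
  define T where "T = (\<lambda>((\<alpha>, u), x). (\<lambda>h. \<alpha> (zW h) :: real, \<lambda>l. u (zU l) :: real, x :: real ^ 'n))"
  have WU: "W \<subseteq> mspace (C0 \<Omega>W)" "U \<subseteq> mspace (C0 \<Omega>U)"
    using compactin_subset_topspace[OF W] compactin_subset_topspace[OF U] by simp_all
  then have top: "topspace ?X = (W \<times> U) \<times> \<Omega>V"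
    by auto
  have comp: "compact_space ?X"
    using compact_space_subtopology[OF W] compact_space_subtopology[OF U]
      compact_space_subtopology[of euclidean \<Omega>V] V
    by (simp add: compact_space_prod_topology)
  have T: "continuous_map ?X euclidean T"
  proof -
    have proj: "continuous_map ?X ?W (fst \<circ> fst)" "continuous_map ?X ?U (snd \<circ> fst)"
      by (rule continuous_map_compose[OF continuous_map_fst continuous_map_fst]
          continuous_map_compose[OF continuous_map_fst continuous_map_snd])+
    have "continuous_map ?X euclidean ((\<lambda>\<alpha> h. \<alpha> (zW h)) \<circ> (fst \<circ> fst))"
      "continuous_map ?X euclidean ((\<lambda>u l. u (zU l)) \<circ> (snd \<circ> fst))"
      by (rule continuous_map_compose[OF proj(1) continuous_map_samples[OF zW(1)]]
          continuous_map_compose[OF proj(2) continuous_map_samples[OF zU(1)]])+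
    moreover have "continuous_map ?X euclidean snd"
      using continuous_map_snd by (rule continuous_map_into_fulltopology)
    ultimately have "continuous_map ?X (prod_topology euclidean (prod_topology euclidean euclidean))
        (\<lambda>s. (((\<lambda>\<alpha> h. \<alpha> (zW h)) \<circ> (fst \<circ> fst)) s, ((\<lambda>u l. u (zU l)) \<circ> (snd \<circ> fst)) s, snd s))"
      by (intro continuous_map_pairedI)
    then show ?thesis
      by (simp add: T_def case_prod_unfold o_def)
  qed
  have S: "S = T ` topspace ?X" unfolding S_def top T_def ..
  \<comment> \<open>Density of the sample points enters here: through \<open>C0_eqI\<close>, equal
    samples force equal functions.\<close>
  have inj: "inj_on T (topspace ?X)"
  proof (rule inj_onI)
    fix s t assume st: "s \<in> topspace ?X" "t \<in> topspace ?X" "T s = T t"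
    obtain \<alpha> u x \<beta> v y where [simp]: "s = ((\<alpha>, u), x)" "t = ((\<beta>, v), y)"
      by (metis surj_pair)
    have mem: "\<alpha> \<in> W" "\<beta> \<in> W" "u \<in> U" "v \<in> U"
      using st(1,2) unfolding top by auto
    have eq: "\<alpha> (zW h) = \<beta> (zW h)" "u (zU h) = v (zU h)" "x = y" for h
      using st(3) by (auto simp: T_def fun_eq_iff)
    have "\<alpha> = \<beta>"
      by (rule C0_eqI[OF _ _ zW]) (use mem WU eq in blast)+
    moreover have "u = v"
      by (rule C0_eqI[OF _ _ zU]) (use mem WU eq in blast)+
    ultimately show "s = t" using eq by simp
  qed
  show "compact S"
    using image_compactin[OF _ T, of "topspace ?X"] comp by (simp add: S compact_space_def)
  \<comment> \<open>A continuous surjection from a compact space onto a Hausdorff space is a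
    quotient map, so functions constant on the fibres of \<open>T\<close> factor
    continuously.\<close>
  have quot: "quotient_map ?X (top_of_set S) T"
    by (intro T1_Spaces.continuous_imp_quotient_map continuous_map_into_subtopology T comp
        Hausdorff_space_subtopology) (auto simp: S)
  let ?G = "\<lambda>((\<alpha>, u), x). G \<alpha> u x"
  have factor: "?G s = ?G t" if st: "s \<in> topspace ?X" "t \<in> topspace ?X" "T s = T t" for s t
    using inj_onD[OF inj st(3,1,2)] by simp
  obtain F where F: "continuous_map (top_of_set S) euclidean F" "\<And>s. s \<in> topspace ?X \<Longrightarrow> F (T s) = ?G s"
    by (rule quotient_map_lift_exists[OF quot continuous_map_operator[OF G] factor]) (assumption | rule that)+
  have "F (\<lambda>h. \<alpha> (zW h), \<lambda>l. u (zU l), x) = G \<alpha> u x" if "\<alpha> \<in> W" "u \<in> U" "x \<in> \<Omega>V" for \<alpha> u x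
    using F(2)[of "((\<alpha>, u), x)"] that unfolding top T_def by simp
  with F(1) show "\<exists>F. continuous_on S F \<and>
      (\<forall>\<alpha>\<in>W. \<forall>u\<in>U. \<forall>x\<in>\<Omega>V. F (\<lambda>h. \<alpha> (zW h), \<lambda>l. u (zU l), x) = G \<alpha> u x)"
    by auto
qed

section \<open>From sums of neuron products to networks\<close>

text \<open>Each neuron product becomes one outer term whose inner sum has length 1, with a single
  neuron in its \<open>param_branch\<close>.\<close>

lemma add_hull_neuron_products_networks:
  fixes g :: "(nat \<Rightarrow> real) \<times> (nat \<Rightarrow> real) \<times> (real ^ 'n) \<Rightarrow> real"
  assumes g: "g \<in> add_hull (neuron_products \<sigma> p)" and p: "0 < p"
  shows "is_MONet \<sigma> p p (\<lambda>a v x. g (a, v, x))" "is_MNO \<sigma> p p (\<lambda>a v x. g (a, v, x))"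
proof -
  \<comment> \<open>Coefficient 0 yields the zero function that \<open>add_hull_repr\<close> asks
    for.\<close>
  have "neuron_product \<sigma> p 0 (\<lambda>_. 0) 0 (\<lambda>_. 0) 0 (0 :: real ^ 'n) 0 = (\<lambda>_. 0)"
    by (simp add: neuron_product_def case_prod_unfold)
  then have "(\<lambda>_. 0) \<in> (neuron_products \<sigma> p :: ((nat \<Rightarrow> real) \<times> (nat \<Rightarrow> real) \<times> (real ^ 'n) \<Rightarrow> real) set)"
    unfolding neuron_products_def mem_Collect_eq by metis
  then obtain N t where N: "N > 0" and t: "\<forall>i. t i \<in> neuron_products \<sigma> p" and gt: "g = (\<lambda>s. \<Sum>i=1..N::nat. t i s)"
    using add_hull_repr[OF g] by blast
  obtain c \<phi> \<rho> \<xi> \<theta> \<omega> \<zeta> where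
    t: "\<And>i. t i = neuron_product \<sigma> p (c i) (\<phi> i) (\<rho> i) (\<xi> i) (\<theta> i) (\<omega> i) (\<zeta> i)"
    using t unfolding neuron_products_def mem_Collect_eq choice_iff by blast
  have "(\<lambda>a v x. g (a, v, x)) = (\<lambda>a v x. \<Sum>k=1..N. \<Sum>i=1..1::nat.
      trunk \<sigma> (\<omega> k) (\<zeta> k) x * branch \<sigma> p (\<xi> k) (\<theta> k) v *
      param_branch \<sigma> p 1 (\<lambda>_. c k) (\<lambda>_. \<phi> k) (\<lambda>_. \<rho> k) a)"
    by (simp add: gt t neuron_product_def param_branch_def mult_ac)
  then show "is_MONet \<sigma> p p (\<lambda>a v x. g (a, v, x))"
    unfolding is_MONet_def using N p
    by (intro conjI exI[of _ 1] exI[of _ N] exI[of _ "\<lambda>k _ _. c k"] exI[of _ "\<lambda>k _ _. \<phi> k"]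
        exI[of _ "\<lambda>k _ _. \<rho> k"] exI[of _ "\<lambda>k _. \<xi> k"] exI[of _ "\<lambda>k _. \<theta> k"] exI[of _ \<omega>] exI[of _ \<zeta>])
      simp_all
  have "(\<lambda>a v x. g (a, v, x)) = (\<lambda>a v x. \<Sum>q=1..N. \<Sum>k=1..1::nat.
      param_branch \<sigma> p 1 (\<lambda>_. c q) (\<lambda>_. \<phi> q) (\<lambda>_. \<rho> q) a *
      branch \<sigma> p (\<xi> q) (\<theta> q) v * trunk \<sigma> (\<omega> q) (\<zeta> q) x)"
    by (simp add: gt t neuron_product_def param_branch_def)
  then show "is_MNO \<sigma> p p (\<lambda>a v x. g (a, v, x))"
    unfolding is_MNO_def using N p
    by (intro conjI exI[of _ N] exI[of _ "\<lambda>_. 1"] exI[of _ "\<lambda>q _. c q"] exI[of _ "\<lambda>q _. \<phi> q"]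
        exI[of _ "\<lambda>q _. \<rho> q"] exI[of _ "\<lambda>q _. \<xi> q"] exI[of _ "\<lambda>q _. \<theta> q"]
        exI[of _ "\<lambda>q _. \<omega> q"] exI[of _ "\<lambda>q _. \<zeta> q"]) simp_all
qed

text \<open>Networks read only the entries with positive index, so the entry 0 of a dense sequence is repeated
  as entry 1.\<close>

lemma dense_sample_points:
  "\<exists>Z :: 'a::metric_space set \<Rightarrow> nat \<Rightarrow> 'a. \<forall>K. compact K \<longrightarrow> K \<noteq> {} \<longrightarrow>
     range (Z K) \<subseteq> K \<and> K \<subseteq> closure (range (Z K)) \<and> Z K 0 = Z K 1"
proof -
  \<comment> \<open>The hypotheses on \<open>K\<close> stay inside the existence claim, so that
    \<open>choice\<close> yields one \<open>Z\<close> defined for all \<open>K\<close>; other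
    \<open>K\<close> are vacuous.\<close>
  have "\<exists>z :: nat \<Rightarrow> 'a. compact K \<longrightarrow> K \<noteq> {} \<longrightarrow> range z \<subseteq> K \<and> K \<subseteq> closure (range z) \<and> z 0 = z 1"
    for K :: "'a set"
  proof (cases "compact K \<and> K \<noteq> {}")
    case True
    then obtain d :: "nat \<Rightarrow> 'a" where d: "range d \<subseteq> K" "K \<subseteq> closure (range d)"
      using compact_dense_sequence by blast
    \<comment> \<open>Truncated subtraction sends both 0 and 1 to 0 and still reaches every index of
      \<open>d\<close>.\<close>
    have "surj (\<lambda>h::nat. h - 1)" by (rule surjI[of _ Suc]) simp
    then have "range (\<lambda>h. d (h - 1)) = range d"
      using image_image[of d "\<lambda>h. h - 1" UNIV] by simp
    with d show ?thesis by (intro exI[of _ "\<lambda>h. d (h - 1)"]) simp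
  qed auto
  then show ?thesis by (intro choice allI)
qed

text \<open>\<open>Z\<close> and \<open>Y\<close> precede \<open>\<sigma>\<close>, \<open>G\<close>
  and \<open>\<epsilon>\<close>, so the sequences of sample points cannot depend on them; only the
  number of samples read may.\<close>

theorem theorem3p4:
  shows "\<exists>(Z :: 'a::banach set \<Rightarrow> ('a \<Rightarrow> real) set \<Rightarrow> nat \<Rightarrow> 'a)
          (Y :: 'u::banach set \<Rightarrow> ('u \<Rightarrow> real) set \<Rightarrow> nat \<Rightarrow> 'u).
    \<forall>(\<sigma> :: real \<Rightarrow> real) \<Omega>W W \<Omega>U U (\<Omega>V :: (real ^ 'n) set) G (\<epsilon> :: real).
      tauber_wiener \<sigma> \<longrightarrow>
      compact \<Omega>W \<longrightarrow> \<Omega>W \<noteq> {} \<longrightarrow> compactin (mtopology_of (C0 \<Omega>W)) W \<longrightarrow>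
      compact \<Omega>U \<longrightarrow> \<Omega>U \<noteq> {} \<longrightarrow> compactin (mtopology_of (C0 \<Omega>U)) U \<longrightarrow>
      compact \<Omega>V \<longrightarrow>
      (\<forall>\<alpha>\<in>W. continuous_map (subtopology (mtopology_of (C0 \<Omega>U)) U) (mtopology_of (C0 \<Omega>V)) (G \<alpha>)) \<longrightarrow>
      continuous_map (subtopology (mtopology_of (C0 \<Omega>W)) W)
        (mtopology_of (C0_maps (C0 \<Omega>U) U (C0 \<Omega>V))) (\<lambda>\<alpha>. restrict (G \<alpha>) U) \<longrightarrow>
      0 < \<epsilon> \<longrightarrow>
      (\<forall>h. Z \<Omega>W W h \<in> \<Omega>W) \<and> (\<forall>l. Y \<Omega>U U l \<in> \<Omega>U) \<and>
      (\<exists>p m NN. is_MONet \<sigma> p m NN \<and>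
         network_error W U \<Omega>V G NN (Z \<Omega>W W) (Y \<Omega>U U) < ennreal \<epsilon>) \<and>
      (\<exists>p m NN. is_MNO \<sigma> p m NN \<and>
         network_error W U \<Omega>V G NN (Z \<Omega>W W) (Y \<Omega>U U) < ennreal \<epsilon>)"
proof -
  obtain Z :: "'a set \<Rightarrow> nat \<Rightarrow> 'a" where Z: "\<And>K. compact K \<Longrightarrow> K \<noteq> {} \<Longrightarrow>
      range (Z K) \<subseteq> K \<and> K \<subseteq> closure (range (Z K)) \<and> Z K 0 = Z K 1"
    using dense_sample_points by blast
  obtain Y :: "'u set \<Rightarrow> nat \<Rightarrow> 'u" where Y: "\<And>K. compact K \<Longrightarrow> K \<noteq> {} \<Longrightarrow>
      range (Y K) \<subseteq> K \<and> K \<subseteq> closure (range (Y K)) \<and> Y K 0 = Y K 1"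
    using dense_sample_points by blast
  show ?thesis
  \<comment> \<open>The witnesses depend on the domains alone: one dense sequence serves all compact
    sets of functions on its domain.\<close>
  proof (rule exI[of _ "\<lambda>K _. Z K"], rule exI[of _ "\<lambda>K _. Y K"], intro allI impI)
    fix \<sigma> :: "real \<Rightarrow> real" and \<Omega>W :: "'a set" and W and \<Omega>U :: "'u set" and U and \<Omega>V :: "(real ^ 'n) set" and G and \<epsilon> :: real
    assume \<sigma>: "tauber_wiener \<sigma>"
      and \<Omega>W: "compact \<Omega>W" "\<Omega>W \<noteq> {}" and W: "compactin (mtopology_of (C0 \<Omega>W)) W"
      and \<Omega>U: "compact \<Omega>U" "\<Omega>U \<noteq> {}" and U: "compactin (mtopology_of (C0 \<Omega>U)) U"
      and V: "compact \<Omega>V"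
      and G: "continuous_map (subtopology (mtopology_of (C0 \<Omega>W)) W)
        (mtopology_of (C0_maps (C0 \<Omega>U) U (C0 \<Omega>V))) (\<lambda>\<alpha>. restrict (G \<alpha>) U)"
      and \<epsilon>: "0 < \<epsilon>"
    define z y where "z = Z \<Omega>W" and "y = Y \<Omega>U"
    have z: "range z \<subseteq> \<Omega>W" "\<Omega>W \<subseteq> closure (range z)" "z 0 = z 1"
      using Z[OF \<Omega>W] by (simp_all add: z_def)
    have y: "range y \<subseteq> \<Omega>U" "\<Omega>U \<subseteq> closure (range y)" "y 0 = y 1"
      using Y[OF \<Omega>U] by (simp_all add: y_def)
    define S where "S = (\<lambda>((\<alpha>, u), x). (\<lambda>h. \<alpha> (z h), \<lambda>l. u (y l), x)) ` ((W \<times> U) \<times> \<Omega>V)"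
    have S: "compact S"
      unfolding S_def by (rule operator_factors_through_samples[OF W U V z(1,2) y(1,2) G])
    obtain F where F: "continuous_on S F"
      "\<And>\<alpha> u x. \<alpha> \<in> W \<Longrightarrow> u \<in> U \<Longrightarrow> x \<in> \<Omega>V \<Longrightarrow> F (\<lambda>h. \<alpha> (z h), \<lambda>l. u (y l), x) = G \<alpha> u x"
      using operator_factors_through_samples(2)[OF W U V z(1,2) y(1,2) G] unfolding S_def by metis
    \<comment> \<open>Two approximations, first by exponentials and then by neurons, each with error
      \<open>\<epsilon> / 4\<close>, add up to the \<open>\<epsilon> / 2\<close> that
      \<open>sup_norm_on_less\<close> expects.\<close>
    have "\<epsilon> / 4 > 0" using \<epsilon> by simp
    \<comment> \<open>Sampling with \<open>z 0 = z 1\<close> and \<open>y 0 = y 1\<close> yields the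
      hypothesis \<open>coord\<close> of \<open>exps_dense\<close>.\<close>
    obtain p f where p: "p > 0" and f: "f \<in> add_hull (exps p)" "\<forall>s\<in>S. \<bar>F s - f s\<bar> < \<epsilon> / 4"
      using exps_dense[OF S F(1) \<open>\<epsilon> / 4 > 0\<close>] z(3) y(3) unfolding S_def by fastforce
    have "approximable S (neuron_products \<sigma> p) f"
      using f(1) by (rule approximable_add_hull) (rule exps_approximable[OF \<sigma> S])
    then obtain g where g: "g \<in> add_hull (neuron_products \<sigma> p)" "\<forall>s\<in>S. \<bar>f s - g s\<bar> < \<epsilon> / 4"
      using \<open>\<epsilon> / 4 > 0\<close> unfolding approximable_def by blast
    have "\<bar>G \<alpha> u x - g (\<lambda>h. \<alpha> (z h), \<lambda>l. u (y l), x)\<bar> \<le> \<epsilon> / 2"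
      if "\<alpha> \<in> W" "u \<in> U" "x \<in> \<Omega>V" for \<alpha> u x
    proof -
      have s: "(\<lambda>h. \<alpha> (z h), \<lambda>l. u (y l), x) \<in> S"
        unfolding S_def using that by force
      show ?thesis using bspec[OF f(2) s] bspec[OF g(2) s] unfolding F(2)[OF that] by linarith
    qed
    then have err: "network_error W U \<Omega>V G (\<lambda>a v x. g (a, v, x)) z y < ennreal \<epsilon>"
      unfolding network_error_def by (intro sup_norm_on_less[OF \<epsilon>]) auto
    show "(\<forall>h. Z \<Omega>W h \<in> \<Omega>W) \<and> (\<forall>l. Y \<Omega>U l \<in> \<Omega>U) \<and>
      (\<exists>p m NN. is_MONet \<sigma> p m NN \<and> network_error W U \<Omega>V G NN (Z \<Omega>W) (Y \<Omega>U) < ennreal \<epsilon>) \<and>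
      (\<exists>p m NN. is_MNO \<sigma> p m NN \<and> network_error W U \<Omega>V G NN (Z \<Omega>W) (Y \<Omega>U) < ennreal \<epsilon>)"
      unfolding z_def[symmetric] y_def[symmetric]
      using z(1) y(1) err add_hull_neuron_products_networks[OF g(1) p] by blast
  qed
qed

end
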